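(* Let $P$ be a probability distribution over $\mathbb R$ that is absolutely continuous with respect to Lebesgue measure, let $R\ge 1$ be an integer, and let $1\le k_1<k_2<\dots<k_r\le R$ be integers. Put $k_0:=0$, let $z_1,\dots,z_r$ be independent random variables with $z_i\sim\mathrm{Beta}(R-k_i+1,\;k_i-k_{i-1})$, and set $$y^{(k_i)}:=\mathrm{CDF}_P^{-1}\Big(\prod_{j=1}^i z_j\Big),\qquad i=1,\dots,r.$$ Then the random vector $(y^{(k_1)},\dots,y^{(k_r)})$ has the same joint distribution as the vector whose $i$-th entry is the $k_i$-th largest element among $x_1,\dots,x_R$, where $x_1,\dots,x_R$ are drawn i.i.d. from $P$.
   Context: $\mathrm{Beta}(\alpha,\beta)$ is the distribution on $[0,1]$ with density $\frac{\Gamma(\alpha+\beta)}{\Gamma(\alpha)\Gamma(\beta)}x^{\alpha-1}(1-x)^{\beta-1}$. $\mathrm{CDF}_P(x):=\Pr_{z\sim P}[z\le x]$, and its inverse is $\mathrm{CDF}_P^{-1}(y):=\min\{x\in\mathbb R:\mathrm{CDF}_P(x)\ge y\}$ for $y\in(0,1)$ (the arguments above lie in $(0,1)$ almost surely). The procedure of drawing the $z_i$ and outputting $(y^{(k_1)},\dots,y^{(k_r)})$ is the paper's algorithm for sampling order statistics. *)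

theory Defs
  imports "HOL-Probability.Probability"
begin

definition beta_density :: "real \<Rightarrow> real \<Rightarrow> real \<Rightarrow> real" where
  "beta_density a b x =
    (if 0 \<le> x \<and> x \<le> 1
     then Gamma (a + b) / (Gamma a * Gamma b) * x powr (a - 1) * (1 - x) powr (b - 1)
     else 0)"

text \<open>
  For \<open>0 < y < 1\<close> the set below has a minimum, because the cdf is right-continuous
  with limits 0 and 1. For other \<open>y\<close> the minimum need not exist and the value is unspecified.
\<close>

definition inv_cdf :: "real measure \<Rightarrow> real \<Rightarrow> real" where
  "inv_cdf P y = (LEAST x. y \<le> cdf P x)"

text \<open>The largest element has index 1; repeated values are counted with multiplicity.\<close>

definition kth_largest :: "nat \<Rightarrow> real list \<Rightarrow> real" where
  "kth_largest k xs = rev (sort xs) ! (k - 1)"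

end

theory Submission
  imports Defs
begin

text \<open>
  The generalised inverse of the cdf maps the uniform law on \<open>(0,1)\<close> to \<open>P\<close> and is monotone there,
  so it commutes with order statistics and it suffices to treat uniform samples.

  The maximum of \<open>n + 1\<close> uniform variables has law \<open>Beta(n + 1, 1)\<close>, and given that it equals \<open>t\<close>
  the other variables are i.i.d. uniform on \<open>(0,t)\<close>, that is, \<open>t\<close> times uniform ones. By
  induction the ascending order statistics with indices \<open>0, \<dots>, R - 1\<close> are jointly distributed
  as the tail products \<open>v\<^sub>i v\<^sub>i\<^sub>+\<^sub>1 \<cdots> v\<^sub>R\<^sub>-\<^sub>1\<close> of independent \<open>v\<^sub>j\<close> with law \<open>Beta(j + 1, 1)\<close>.

  Selecting the indices \<open>R - k\<^sub>i\<close> groups the factors into disjoint blocks, whose products are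
  independent. Because a product of independent \<open>Beta(a + 1, b)\<close> and \<open>Beta(a, 1)\<close> variables has
  law \<open>Beta(a, b + 1)\<close>, the \<open>i\<close>-th block product has the law of \<open>z\<^sub>i\<close>.
\<close>

section \<open>The uniform law\<close>

definition unit_uniform :: "real measure" where
  "unit_uniform = density lborel (indicator {0<..<1})"

lemma sets_unit_uniform [measurable_cong, simp]: "sets unit_uniform = sets borel"
  by (simp add: unit_uniform_def)

lemma space_unit_uniform [simp]: "space unit_uniform = UNIV"
  by (simp add: unit_uniform_def)

lemma prob_space_unit_uniform: "prob_space unit_uniform"
  by (rule prob_spaceI) (simp add: unit_uniform_def emeasure_density)

lemma AE_unit_uniform: "AE t in unit_uniform. 0 < t \<and> t < 1"
  unfolding unit_uniform_def by (subst AE_density) (auto simp: indicator_def)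

interpretation U: product_sigma_finite "\<lambda>_. unit_uniform"
  by (simp add: product_sigma_finite_def prob_space_unit_uniform prob_space_imp_sigma_finite)

lemma nn_integral_unit_uniform:
  "f \<in> borel_measurable borel \<Longrightarrow>
    (\<integral>\<^sup>+x. f x \<partial>unit_uniform) = (\<integral>\<^sup>+x. f x * indicator {0<..<1} x \<partial>lborel)"
  unfolding unit_uniform_def by (subst nn_integral_density) (simp_all add: mult.commute)

text \<open>The substitution \<open>x = t * y\<close> maps \<open>(0,1)\<close> onto
  \<open>(0,t)\<close>. Whether \<open>E\<close> contains the endpoint \<open>t\<close> does not
  change the integral, a point being a null set; tie-breaking for the maximum produces both
  forms.\<close>

lemma nn_integral_unit_uniform_scale:
  fixes t :: real
  assumes t: "0 < t" "t < 1" and E: "E = {..t} \<or> E = {..<t}"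
    and f[measurable]: "f \<in> borel_measurable borel"
  shows "(\<integral>\<^sup>+x. f x * indicator E x \<partial>unit_uniform) = ennreal t * (\<integral>\<^sup>+x. f (t * x) \<partial>unit_uniform)"
proof -
  have [measurable]: "E \<in> sets borel" using E by auto
  have "(\<integral>\<^sup>+x. f x * indicator E x \<partial>unit_uniform)
      = (\<integral>\<^sup>+x. f x * indicator E x * indicator {0<..<1} x \<partial>lborel)"
    by (rule nn_integral_unit_uniform) measurable
  also have "\<dots> = (\<integral>\<^sup>+x. f x * indicator {0<..<t} x \<partial>lborel)"
    using AE_lborel_singleton[of t] t E
    by (intro nn_integral_cong_AE) (auto elim!: eventually_mono split: split_indicator)
  also have "\<dots> = ennreal t * (\<integral>\<^sup>+x. f (t * x) * indicator {0<..<t} (t * x) \<partial>lborel)"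
    using t by (subst nn_integral_real_affine[where c = t and t = 0]) auto
  also have "(\<integral>\<^sup>+x. f (t * x) * indicator {0<..<t} (t * x) \<partial>lborel)
      = (\<integral>\<^sup>+x. f (t * x) * indicator {0<..<1} x \<partial>lborel)"
    using t by (intro nn_integral_cong) (auto split: split_indicator simp: zero_less_mult_iff)
  also have "\<dots> = (\<integral>\<^sup>+x. f (t * x) \<partial>unit_uniform)"
    by (rule nn_integral_unit_uniform[symmetric]) measurable
  finally show ?thesis .
qed

text \<open>Uniform variables conditioned to lie below \<open>t\<close> are \<open>t\<close> times
  uniform ones, and \<open>t ^ card I\<close> is the probability of the condition. Induction on
  \<open>I\<close> splits off one coordinate at a time by Fubini.\<close>

lemma nn_integral_PiM_unit_uniform_scale:
  fixes t :: real and f :: "('i \<Rightarrow> real) \<Rightarrow> ennreal"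
  assumes t: "0 < t" "t < 1" and I: "finite I" and E: "\<And>i. E i = {..t} \<or> E i = {..<t}"
    and f: "f \<in> borel_measurable (PiM I (\<lambda>_. borel))"
  shows "(\<integral>\<^sup>+u. f u * (\<Prod>i\<in>I. indicator (E i) (u i)) \<partial>PiM I (\<lambda>_. unit_uniform))
       = ennreal t ^ card I * (\<integral>\<^sup>+u. f (\<lambda>i\<in>I. t * u i) \<partial>PiM I (\<lambda>_. unit_uniform))"
  using I f
proof (induction I arbitrary: f)
  case empty
  then show ?case by (simp add: PiM_empty nn_integral_count_space_finite)
next
  case (insert m I f)
  note [measurable] = insert.prems
  have [measurable]: "E i \<in> sets borel" for i using E[of i] by (elim disjE) simp_all
  have [measurable]: "(\<lambda>u. u(m := y)) \<in> measurable (PiM I (\<lambda>_. borel)) (PiM (insert m I) (\<lambda>_. borel))" for y :: real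
    by (rule measurable_fun_upd[where J = I]) (simp, measurable)
  have [measurable]: "(\<lambda>u. (\<lambda>i\<in>I. t * u i)(m := y)) \<in> measurable (PiM I (\<lambda>_. borel)) (PiM (insert m I) (\<lambda>_. borel))" for y :: real
    by (rule measurable_fun_upd[where J = I]) (simp, measurable)
  interpret PI: sigma_finite_measure "PiM I (\<lambda>_. unit_uniform)"
    using insert.hyps by (intro U.sigma_finite)
  have "(\<lambda>p. (\<lambda>i\<in>I. t * snd p i)(m := fst p))
      \<in> measurable (borel \<Otimes>\<^sub>M PiM I (\<lambda>_. borel)) (PiM (insert m I) (\<lambda>_. borel))"
    by (rule measurable_fun_upd[where J = I]) (simp, measurable)
  from measurable_compose[OF this insert.prems]
  have "(\<lambda>(y, u). f ((\<lambda>i\<in>I. t * u i)(m := y))) \<in> borel_measurable (borel \<Otimes>\<^sub>M PiM I (\<lambda>_. unit_uniform))"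
    by (simp add: case_prod_beta cong: measurable_cong_sets sets_PiM_cong sets_pair_measure_cong)
  then have K[measurable]: "(\<lambda>y. \<integral>\<^sup>+u. f ((\<lambda>i\<in>I. t * u i)(m := y)) \<partial>PiM I (\<lambda>_. unit_uniform)) \<in> borel_measurable borel"
    by (rule PI.borel_measurable_nn_integral)
  have [simp]: "(\<Prod>i\<in>I. indicator (E i) (if i = m then y else u i)) = (\<Prod>i\<in>I. indicator (E i) (u i) :: ennreal)" for y u
    using insert.hyps by (intro prod.cong) auto
  have "(\<integral>\<^sup>+u. f u * (\<Prod>i\<in>insert m I. indicator (E i) (u i)) \<partial>PiM (insert m I) (\<lambda>_. unit_uniform))
     = (\<integral>\<^sup>+y. \<integral>\<^sup>+u. (f (u(m := y)) * (\<Prod>i\<in>I. indicator (E i) (u i))) * indicator (E m) y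
          \<partial>PiM I (\<lambda>_. unit_uniform) \<partial>unit_uniform)"
    using insert.hyps by (subst U.product_nn_integral_insert_rev) (auto simp: mult_ac)
  \<comment> \<open>For fixed \<open>y\<close> the induction hypothesis is applied to
    \<open>\<lambda>u. f (u(m := y))\<close>; the one-dimensional scaling then treats
    \<open>y\<close> itself.\<close>
  also have "\<dots> = (\<integral>\<^sup>+y. (ennreal t ^ card I *
      (\<integral>\<^sup>+u. f ((\<lambda>i\<in>I. t * u i)(m := y)) \<partial>PiM I (\<lambda>_. unit_uniform))) * indicator (E m) y \<partial>unit_uniform)"
    by (intro nn_integral_cong, subst nn_integral_multc, measurable)
       (subst insert.IH, simp_all)
  also have "\<dots> = ennreal t * (\<integral>\<^sup>+y. ennreal t ^ card I *
      (\<integral>\<^sup>+u. f ((\<lambda>i\<in>I. t * u i)(m := t * y)) \<partial>PiM I (\<lambda>_. unit_uniform)) \<partial>unit_uniform)"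
    by (rule nn_integral_unit_uniform_scale[OF t E]) measurable
  also have "\<dots> = ennreal t ^ card (insert m I) *
      (\<integral>\<^sup>+y. \<integral>\<^sup>+u. f ((\<lambda>i\<in>I. t * u i)(m := t * y)) \<partial>PiM I (\<lambda>_. unit_uniform) \<partial>unit_uniform)"
    using insert.hyps measurable_compose[OF _ K, of "\<lambda>y. t * y" borel]
    by (subst nn_integral_cmult) (simp_all add: mult_ac)
  also have "(\<integral>\<^sup>+y. \<integral>\<^sup>+u. f ((\<lambda>i\<in>I. t * u i)(m := t * y)) \<partial>PiM I (\<lambda>_. unit_uniform) \<partial>unit_uniform)
     = (\<integral>\<^sup>+u. f (\<lambda>i\<in>insert m I. t * u i) \<partial>PiM (insert m I) (\<lambda>_. unit_uniform))"
    using insert.hyps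
    by (subst U.product_nn_integral_insert_rev)
       (auto intro!: nn_integral_cong arg_cong[where f = f])
  finally show ?case .
qed

section \<open>Order statistics\<close>

text \<open>Ascending order and index from 0, so the \<open>k\<close>-th largest of \<open>R\<close> values has index \<open>R - k\<close>.\<close>

definition order_stat :: "'i set \<Rightarrow> ('i \<Rightarrow> real) \<Rightarrow> nat \<Rightarrow> real" where
  "order_stat I u i = sorted_list_of_multiset (image_mset u (mset_set I)) ! i"

text \<open>The entries at most \<open>c\<close> form an initial segment of a sorted list, so
  position \<open>i\<close> belongs to it exactly when the segment has more than \<open>i\<close>
  entries.\<close>

lemma sorted_nth_le_iff:
  fixes xs :: "'a::linorder list"
  assumes "sorted xs" "i < length xs"
  shows "xs ! i \<le> c \<longleftrightarrow> i < length (filter (\<lambda>x. x \<le> c) xs)"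
  using assms
proof (induction xs arbitrary: i)
  case (Cons x xs)
  have "filter (\<lambda>x. x \<le> c) xs = []" if "c < x"
    using Cons.prems that by (force simp: filter_empty_conv)
  with Cons show ?case by (cases i) (force simp: not_le)+
qed simp

text \<open>Sublevel sets of order statistics become counting conditions, from which measurability
  follows.\<close>

lemma order_stat_le_iff:
  assumes "finite I" "i < card I"
  shows "order_stat I u i \<le> c \<longleftrightarrow> i < card {j\<in>I. u j \<le> c}"
proof -
  let ?A = "image_mset u (mset_set I)"
  have "length (filter (\<lambda>x. x \<le> c) (sorted_list_of_multiset ?A)) = size (filter_mset (\<lambda>x. x \<le> c) ?A)"
    by (metis mset_filter mset_sorted_list_of_multiset size_mset)
  also have "\<dots> = card {j\<in>I. u j \<le> c}"
    using assms by (simp add: filter_mset_image_mset filter_mset_mset_set)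
  finally show ?thesis
    using assms unfolding order_stat_def by (subst sorted_nth_le_iff) (simp_all flip: size_mset)
qed

lemma measurable_order_stat [measurable]:
  assumes I: "finite I" "i < card I"
  shows "(\<lambda>u. order_stat I u i) \<in> borel_measurable (PiM I (\<lambda>_. borel))"
proof -
  have *: "real (card {j\<in>I. u j \<le> c}) = (\<Sum>j\<in>I. indicator {..c} (u j))" for u c
    using I by (simp add: indicator_def sum.If_cases Int_def)
  have "order_stat I u i \<le> c \<longleftrightarrow> real i < (\<Sum>j\<in>I. indicator {..c} (u j))" for u c
    unfolding *[symmetric] using order_stat_le_iff[OF I, of u c] by simp
  then show ?thesis
    by (intro borel_measurableI_le) simp
qed

text \<open>A monotone map keeps the sorted list sorted. Monotonicity is asked only on a set
  \<open>S\<close> containing the sample, so that the quantile function on \<open>(0,1)\<close> is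
  covered as well as scaling by \<open>t\<close>.\<close>

lemma order_stat_map:
  assumes I: "finite I" "i < card I" and g: "mono_on S g" and u: "u ` I \<subseteq> S"
  shows "order_stat I (\<lambda>j. g (u j)) i = g (order_stat I u i)"
proof -
  let ?xs = "sorted_list_of_multiset (image_mset u (mset_set I))"
  have S: "set ?xs \<subseteq> S" using I u by simp
  have "sorted_wrt (\<lambda>x y. g x \<le> g y) ?xs"
    by (rule sorted_wrt_mono_rel[OF _ sorted_sorted_list_of_multiset])
       (use S in \<open>auto intro!: mono_onD[OF g]\<close>)
  then have "sorted (map g ?xs)" by (simp add: sorted_map)
  moreover have "mset (map g ?xs) = image_mset (\<lambda>j. g (u j)) (mset_set I)"
    by (simp add: image_mset.compositionality comp_def)
  ultimately have "sorted_list_of_multiset (image_mset (\<lambda>j. g (u j)) (mset_set I)) = map g ?xs"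
    by (metis sorted_list_of_multiset_mset sorted_sort_id)
  moreover have "i < length ?xs" using I by (simp flip: size_mset)
  ultimately show ?thesis by (simp add: order_stat_def)
qed

text \<open>A value that dominates all others goes to the end of the sorted list, so it takes the
  top index \<open>card I\<close> and moves no other entry.\<close>

lemma order_stat_insert_max:
  assumes I: "finite I" "m \<notin> I" and t: "\<And>j. j \<in> I \<Longrightarrow> u j \<le> t" and i: "i \<le> card I"
  shows "order_stat (insert m I) (u(m := t)) i = (if i = card I then t else order_stat I u i)"
proof -
  let ?xs = "sorted_list_of_multiset (image_mset u (mset_set I))"
  have len: "length ?xs = card I" by (simp flip: size_mset)
  have "image_mset (u(m := t)) (mset_set I) = image_mset u (mset_set I)"
    using I by (intro image_mset_cong) auto
  then have "mset (?xs @ [t]) = image_mset (u(m := t)) (mset_set (insert m I))"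
    using I by simp
  moreover have "sorted (?xs @ [t])" using t I by (auto simp: sorted_append)
  ultimately have "sorted_list_of_multiset (image_mset (u(m := t)) (mset_set (insert m I))) = ?xs @ [t]"
    by (metis sorted_list_of_multiset_mset sorted_sort_id)
  then show ?thesis using i len by (simp add: order_stat_def nth_append)
qed

section \<open>Beta laws with integer parameters\<close>

definition beta_law :: "real \<Rightarrow> real \<Rightarrow> real measure" where
  "beta_law a b = density lborel (\<lambda>t. ennreal (beta_density a b t))"

lemma borel_measurable_beta_density [measurable]: "beta_density a b \<in> borel_measurable borel"
  unfolding beta_density_def[abs_def] by measurable

lemma sets_beta_law [measurable_cong, simp]: "sets (beta_law a b) = sets borel"
  by (simp add: beta_law_def)

lemma space_beta_law [simp]: "space (beta_law a b) = UNIV"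
  by (simp add: beta_law_def)

lemma nn_integral_beta_law:
  "f \<in> borel_measurable borel \<Longrightarrow>
    (\<integral>\<^sup>+x. f x \<partial>beta_law a b) = (\<integral>\<^sup>+x. ennreal (beta_density a b x) * f x \<partial>lborel)"
  unfolding beta_law_def by (subst nn_integral_density) simp_all

text \<open>At positive integers the Gamma values are factorials. The endpoints are left out because
  \<open>0 powr 0 = 0\<close> whereas \<open>0 ^ 0 = 1\<close>.\<close>

lemma beta_density_of_nat:
  assumes "0 < x" "x < 1"
  shows "beta_density (real (Suc i)) (real (Suc k)) x
    = fact (Suc (i + k)) / (fact i * fact k) * x ^ i * (1 - x) ^ k"
proof -
  have "Gamma (real (Suc i)) = fact i" "Gamma (real (Suc k)) = fact k"
    "Gamma (real (Suc i) + real (Suc k)) = fact (Suc (i + k))"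
    using Gamma_fact[of i, where 'a=real] Gamma_fact[of k, where 'a=real] Gamma_fact[of "Suc (i + k)", where 'a=real]
    by (simp_all add: add_ac)
  with assms show ?thesis by (simp add: beta_density_def powr_realpow del: fact_Suc)
qed

lemma nn_integral_beta_law_of_nat:
  assumes [measurable]: "f \<in> borel_measurable borel"
  shows "(\<integral>\<^sup>+x. f x \<partial>beta_law (real (Suc i)) (real (Suc k)))
    = (\<integral>\<^sup>+x. ennreal (fact (Suc (i + k)) / (fact i * fact k) * x ^ i * (1 - x) ^ k) * f x \<partial>unit_uniform)"
proof -
  have eq: "ennreal (beta_density (real (Suc i)) (real (Suc k)) x) * f x
      = ennreal (fact (Suc (i + k)) / (fact i * fact k) * x ^ i * (1 - x) ^ k) * f x * indicator {0<..<1} x"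
    if "x \<noteq> 0" "x \<noteq> 1" for x
  proof (cases "0 < x \<and> x < 1")
    case True
    then show ?thesis by (simp add: beta_density_of_nat del: of_nat_Suc fact_Suc)
  qed (use that in \<open>auto simp: beta_density_def indicator_def\<close>)
  show ?thesis
    \<comment> \<open>The endpoints, where the two integrands may differ, form a null set.\<close>
    using AE_lborel_singleton[of 0] AE_lborel_singleton[of 1]
    by (subst nn_integral_beta_law, simp, subst nn_integral_unit_uniform, simp, intro nn_integral_cong_AE, eventually_elim)
       (rule eq)
qed

lemma nn_integral_beta_law_Suc_1:
  assumes "f \<in> borel_measurable borel"
  shows "(\<integral>\<^sup>+x. f x \<partial>beta_law (real (Suc n)) 1) = (\<integral>\<^sup>+x. ennreal (real (Suc n) * x ^ n) * f x \<partial>unit_uniform)"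
  using nn_integral_beta_law_of_nat[OF assms, of n 0] by simp

text \<open>Splits the density of the maximum of \<open>n + 1\<close> uniform variables into the
  number of candidates and the probability \<open>x ^ n\<close> that the other variables lie below
  \<open>x\<close>.\<close>

lemma nn_integral_beta_law_Suc_1_cmult:
  assumes [measurable]: "f \<in> borel_measurable borel"
  shows "(\<integral>\<^sup>+x. f x \<partial>beta_law (real (Suc n)) 1) = of_nat (Suc n) * (\<integral>\<^sup>+x. ennreal x ^ n * f x \<partial>unit_uniform)"
proof -
  have "(\<integral>\<^sup>+x. f x \<partial>beta_law (real (Suc n)) 1) = (\<integral>\<^sup>+x. ennreal (real (Suc n) * x ^ n) * f x \<partial>unit_uniform)"
    by (rule nn_integral_beta_law_Suc_1) measurable
  also have "\<dots> = (\<integral>\<^sup>+x. of_nat (Suc n) * (ennreal x ^ n * f x) \<partial>unit_uniform)"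
    by (intro nn_integral_cong_AE, use AE_unit_uniform in eventually_elim)
       (simp add: ennreal_mult ennreal_power ennreal_of_nat_eq_real_of_nat mult.assoc del: of_nat_Suc)
  also have "\<dots> = of_nat (Suc n) * (\<integral>\<^sup>+x. ennreal x ^ n * f x \<partial>unit_uniform)"
    by (rule nn_integral_cmult) measurable
  finally show ?thesis .
qed

interpretation B: product_sigma_finite "\<lambda>j. beta_law (real (Suc j)) 1"
  unfolding product_sigma_finite_def beta_law_def
  by (subst sigma_finite_measure.sigma_finite_iff_density_finite[OF sigma_finite_lborel]) simp_all

text \<open>An antiderivative is \<open>- ((1 - x) ^ Suc k / real (Suc k))\<close>. The range
  \<open>x > t\<close> is written as \<open>indicator {..<x} t\<close>, the form in which it arises
  when integrals are exchanged.\<close>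

lemma nn_integral_unit_uniform_upper_tail:
  assumes "0 < t" "t < 1"
  shows "(\<integral>\<^sup>+x. ennreal ((1 - x) ^ k) * indicator {..<x} t \<partial>unit_uniform) = ennreal ((1 - t) ^ Suc k / real (Suc k))"
proof -
  have [measurable]: "(\<lambda>x. indicator {..<x} t :: ennreal) \<in> borel_measurable borel"
    by (simp add: indicator_def)
  have "(\<integral>\<^sup>+x. ennreal ((1 - x) ^ k) * indicator {..<x} t \<partial>unit_uniform)
     = (\<integral>\<^sup>+x. ennreal ((1 - x) ^ k) * indicator {..<x} t * indicator {0<..<1} x \<partial>lborel)"
    by (rule nn_integral_unit_uniform) measurable
  also have "\<dots> = (\<integral>\<^sup>+x. ennreal ((1 - x) ^ k) * indicator {t..1} x \<partial>lborel)"
    using AE_lborel_singleton[of t] AE_lborel_singleton[of 1] assms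
    by (intro nn_integral_cong_AE) (auto elim!: eventually_elim2 split: split_indicator)
  also have "\<dots> = ennreal (- ((1 - 1) ^ Suc k / real (Suc k)) - - ((1 - t) ^ Suc k / real (Suc k)))"
  proof (rule nn_integral_FTC_Icc)
    fix x :: real
    show "((\<lambda>x. - ((1 - x) ^ Suc k / real (Suc k))) has_real_derivative (1 - x) ^ k) (at x)"
      by (rule derivative_eq_intros refl | simp del: of_nat_Suc power_Suc)+
  qed (use assms in auto)
  finally show ?thesis by simp
qed

text \<open>Under the substitution \<open>t = y * x\<close> one factor \<open>x\<close> of the
  density is absorbed by \<open>dt = x dy\<close>, and the remaining \<open>x ^ i * y ^ i\<close> is
  \<open>t ^ i\<close>. Exchanging the integrals leaves the integral of \<open>(1 - x) ^ k\<close>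
  over \<open>x > t\<close>, which raises the exponent of \<open>1 - t\<close> to
  \<open>Suc k\<close>.\<close>

lemma nn_integral_beta_law_mult:
  assumes [measurable]: "f \<in> borel_measurable borel"
  shows "(\<integral>\<^sup>+x. \<integral>\<^sup>+y. f (y * x) \<partial>beta_law (real (Suc i)) 1 \<partial>beta_law (real (Suc (Suc i))) (real (Suc k)))
    = (\<integral>\<^sup>+t. f t \<partial>beta_law (real (Suc i)) (real (Suc (Suc k))))"
proof -
  \<comment> \<open>\<open>c\<close> is the normalising constant of Beta(i + 2, k + 1).\<close>
  define c where "c = (fact (Suc (Suc i + k)) / (fact (Suc i) * fact k) :: real)"
  have c: "c \<ge> 0" by (simp add: c_def)
  interpret sigma_finite_measure "beta_law (real (Suc i)) 1"
    by (rule B.sigma_finite_measures)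
  interpret UU: pair_sigma_finite unit_uniform unit_uniform
    by (intro pair_sigma_finite.intro prob_space_imp_sigma_finite prob_space_unit_uniform)
  have [measurable]: "(\<lambda>(x::real, t). indicator {..<x} t :: ennreal) \<in> borel_measurable (borel \<Otimes>\<^sub>M borel)"
    unfolding indicator_def of_bool_def lessThan_iff by measurable
  have inner: "ennreal (c * x ^ Suc i * (1 - x) ^ k) * (\<integral>\<^sup>+y. f (y * x) \<partial>beta_law (real (Suc i)) 1)
      = (\<integral>\<^sup>+t. ennreal (c * (1 - x) ^ k) * (ennreal (real (Suc i) * t ^ i) * f t * indicator {..<x} t) \<partial>unit_uniform)"
    if x: "0 < x" "x < 1" for x
  proof -
    have "(\<integral>\<^sup>+y. f (y * x) \<partial>beta_law (real (Suc i)) 1)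
        = (\<integral>\<^sup>+y. ennreal (real (Suc i) * y ^ i) * f (y * x) \<partial>unit_uniform)"
      by (rule nn_integral_beta_law_Suc_1) measurable
    then have "ennreal (x ^ Suc i) * (\<integral>\<^sup>+y. f (y * x) \<partial>beta_law (real (Suc i)) 1)
        = ennreal x * (ennreal (x ^ i) * (\<integral>\<^sup>+y. ennreal (real (Suc i) * y ^ i) * f (y * x) \<partial>unit_uniform))"
      using x by (simp add: ennreal_mult mult_ac)
    also have "ennreal (x ^ i) * (\<integral>\<^sup>+y. ennreal (real (Suc i) * y ^ i) * f (y * x) \<partial>unit_uniform)
       = (\<integral>\<^sup>+y. ennreal (x ^ i) * (ennreal (real (Suc i) * y ^ i) * f (y * x)) \<partial>unit_uniform)"
      by (rule nn_integral_cmult[symmetric]) measurable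
    also have "\<dots> = (\<integral>\<^sup>+y. ennreal (real (Suc i) * (x * y) ^ i) * f (x * y) \<partial>unit_uniform)"
    proof (rule nn_integral_cong)
      fix y :: real
      have "real (Suc i) * (x * y) ^ i = x ^ i * (real (Suc i) * y ^ i)"
        by (simp only: power_mult_distrib mult_ac)
      then have "ennreal (real (Suc i) * (x * y) ^ i) = ennreal (x ^ i) * ennreal (real (Suc i) * y ^ i)"
        using x by (simp only: ennreal_mult' zero_le_power less_imp_le)
      then show "ennreal (x ^ i) * (ennreal (real (Suc i) * y ^ i) * f (y * x))
          = ennreal (real (Suc i) * (x * y) ^ i) * f (x * y)"
        by (simp only: mult.assoc mult.commute[of x y])
    qed
    also have "ennreal x * \<dots> = (\<integral>\<^sup>+t. ennreal (real (Suc i) * t ^ i) * f t * indicator {..<x} t \<partial>unit_uniform)"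
      using x by (intro nn_integral_unit_uniform_scale[symmetric]) auto
    finally have "ennreal (x ^ Suc i) * (\<integral>\<^sup>+y. f (y * x) \<partial>beta_law (real (Suc i)) 1) = \<dots>" .
    then have "ennreal (c * (1 - x) ^ k) * (ennreal (x ^ Suc i) * (\<integral>\<^sup>+y. f (y * x) \<partial>beta_law (real (Suc i)) 1))
      = (\<integral>\<^sup>+t. ennreal (c * (1 - x) ^ k) * (ennreal (real (Suc i) * t ^ i) * f t * indicator {..<x} t) \<partial>unit_uniform)"
      by (simp add: nn_integral_cmult)
    then show ?thesis
      using x c by (simp add: ennreal_mult mult_ac)
  qed
  have outer: "(\<integral>\<^sup>+x. ennreal (c * (1 - x) ^ k) * (ennreal (real (Suc i) * t ^ i) * f t * indicator {..<x} t) \<partial>unit_uniform)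
     = ennreal (fact (Suc (i + Suc k)) / (fact i * fact (Suc k)) * t ^ i * (1 - t) ^ Suc k) * f t"
    if t: "0 < t" "t < 1" for t
  proof -
    have "(\<integral>\<^sup>+x. ennreal (c * (1 - x) ^ k) * (ennreal (real (Suc i) * t ^ i) * f t * indicator {..<x} t) \<partial>unit_uniform)
       = (\<integral>\<^sup>+x. (ennreal c * ennreal (real (Suc i) * t ^ i) * f t) * (ennreal ((1 - x) ^ k) * indicator {..<x} t) \<partial>unit_uniform)"
      using c by (intro nn_integral_cong_AE, use AE_unit_uniform in eventually_elim) (simp add: ennreal_mult mult_ac)
    also have "\<dots> = (ennreal c * ennreal (real (Suc i) * t ^ i) * f t) * ennreal ((1 - t) ^ Suc k / real (Suc k))"
      by (subst nn_integral_cmult) (simp_all only: nn_integral_unit_uniform_upper_tail[OF t], measurable)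
    also have "\<dots> = ennreal (c * (real (Suc i) * t ^ i) * ((1 - t) ^ Suc k / real (Suc k))) * f t"
    proof -
      have mult3: "ennreal (a * b * d) = ennreal a * ennreal b * ennreal d" if "0 \<le> a" "0 \<le> b" "0 \<le> d" for a b d :: real
        using that by (simp add: ennreal_mult)
      have "0 \<le> real (Suc i) * t ^ i" "0 \<le> (1 - t) ^ Suc k / real (Suc k)"
        using t by (intro mult_nonneg_nonneg divide_nonneg_nonneg zero_le_power; simp)+
      from mult3[OF c this] show ?thesis by (simp only: mult_ac)
    qed
    \<comment> \<open>The factor \<open>i + 1\<close> turns \<open>(i + 1)!\<close> in the
      denominator of \<open>c\<close> into \<open>i!\<close>, and the divisor \<open>k + 1\<close>
      turns \<open>k!\<close> into \<open>(k + 1)!\<close>: the constant of Beta(i + 1, k +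
      2).\<close>
    also have "c * (real (Suc i) * t ^ i) * ((1 - t) ^ Suc k / real (Suc k))
        = fact (Suc (i + Suc k)) / (fact i * fact (Suc k)) * t ^ i * (1 - t) ^ Suc k"
    proof -
      have "fact (Suc (Suc i + k)) = (fact (Suc (i + Suc k)) :: real)" by simp
      then have eq: "c * real (Suc i) / real (Suc k) = fact (Suc (i + Suc k)) / (fact i * fact (Suc k))"
        unfolding c_def fact_Suc[of i] fact_Suc[of k] by (simp del: fact_Suc of_nat_Suc)
      have "c * (a * b) * (d / e) = c * a / e * b * d" for a b d e
        by (simp add: divide_inverse mult_ac)
      from this[of "real (Suc i)" "t ^ i" "(1 - t) ^ Suc k" "real (Suc k)"] show ?thesis unfolding eq .
    qed
    finally show ?thesis .
  qed
  have "(\<integral>\<^sup>+x. \<integral>\<^sup>+y. f (y * x) \<partial>beta_law (real (Suc i)) 1 \<partial>beta_law (real (Suc (Suc i))) (real (Suc k)))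
     = (\<integral>\<^sup>+x. ennreal (c * x ^ Suc i * (1 - x) ^ k) * (\<integral>\<^sup>+y. f (y * x) \<partial>beta_law (real (Suc i)) 1) \<partial>unit_uniform)"
    unfolding c_def by (rule nn_integral_beta_law_of_nat) measurable
  also have "\<dots> = (\<integral>\<^sup>+x. \<integral>\<^sup>+t. ennreal (c * (1 - x) ^ k) * (ennreal (real (Suc i) * t ^ i) * f t * indicator {..<x} t) \<partial>unit_uniform \<partial>unit_uniform)"
    by (intro nn_integral_cong_AE, use AE_unit_uniform in eventually_elim) (simp only: inner)
  also have "\<dots> = (\<integral>\<^sup>+t. \<integral>\<^sup>+x. ennreal (c * (1 - x) ^ k) * (ennreal (real (Suc i) * t ^ i) * f t * indicator {..<x} t) \<partial>unit_uniform \<partial>unit_uniform)"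
    by (rule UU.Fubini') measurable
  also have "\<dots> = (\<integral>\<^sup>+t. ennreal (fact (Suc (i + Suc k)) / (fact i * fact (Suc k)) * t ^ i * (1 - t) ^ Suc k) * f t \<partial>unit_uniform)"
    by (intro nn_integral_cong_AE, use AE_unit_uniform in eventually_elim) (simp only: outer)
  also have "\<dots> = (\<integral>\<^sup>+t. f t \<partial>beta_law (real (Suc i)) (real (Suc (Suc k))))"
    by (rule nn_integral_beta_law_of_nat[symmetric]) measurable
  finally show ?thesis .
qed

lemma prob_space_beta_law_Suc_1: "prob_space (beta_law (real (Suc n)) 1)"
proof (rule prob_spaceI)
  have "emeasure (beta_law (real (Suc n)) 1) (space (beta_law (real (Suc n)) 1))
      = (\<integral>\<^sup>+x. 1 \<partial>beta_law (real (Suc n)) 1)" by simp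
  also have "\<dots> = (\<integral>\<^sup>+x. ennreal (real (Suc n) * x ^ n) * indicator {0<..<1} x \<partial>lborel)"
    by (subst nn_integral_beta_law_Suc_1, simp, subst nn_integral_unit_uniform) simp_all
  also have "\<dots> = (\<integral>\<^sup>+x. ennreal (real (Suc n) * x ^ n) * indicator {0..1} x \<partial>lborel)"
    using AE_lborel_singleton[of 0] AE_lborel_singleton[of 1]
    by (intro nn_integral_cong_AE) (auto elim!: eventually_elim2 split: split_indicator)
  also have "\<dots> = ennreal (1 ^ Suc n - 0 ^ Suc n)"
  proof (rule nn_integral_FTC_Icc)
    show "((\<lambda>x. x ^ Suc n) has_real_derivative real (Suc n) * x ^ n) (at x)" for x :: real
      using DERIV_pow[of "Suc n" x UNIV] by simp
  qed auto
  finally show "emeasure (beta_law (real (Suc n)) 1) (space (beta_law (real (Suc n)) 1)) = 1"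
    by simp
qed

text \<open>Induction on the number of factors, splitting off the lowest index: the factors from
  \<open>Suc i\<close> on have a product with law Beta(i + 2, k + 1), and multiplying by an
  independent Beta(i + 1, 1) variable gives Beta(i + 1, k + 2).\<close>

lemma nn_integral_prod_beta_law:
  assumes "f \<in> borel_measurable borel"
  shows "(\<integral>\<^sup>+v. f (\<Prod>l\<in>{i..<i + Suc k}. v l) \<partial>PiM {i..<i + Suc k} (\<lambda>j. beta_law (real (Suc j)) 1))
    = (\<integral>\<^sup>+t. f t \<partial>beta_law (real (Suc i)) (real (Suc k)))"
  using assms
proof (induction k arbitrary: i f)
  case 0
  note [measurable] = 0
  have "{i..<i + Suc 0} = {i}" by auto
  then show ?case using B.product_nn_integral_singleton[of f i] by simp
next
  case (Suc k i f)
  note [measurable] = Suc.prems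
  let ?J = "{Suc i..<Suc i + Suc k}"
  have J: "{i..<i + Suc (Suc k)} = insert i ?J" "finite ?J" "i \<notin> ?J" by auto
  interpret sigma_finite_measure "beta_law (real (Suc i)) 1"
    by (rule B.sigma_finite_measures)
  have "(\<integral>\<^sup>+v. f (\<Prod>l\<in>insert i ?J. v l) \<partial>PiM (insert i ?J) (\<lambda>j. beta_law (real (Suc j)) 1))
     = (\<integral>\<^sup>+v. \<integral>\<^sup>+y. f (\<Prod>l\<in>insert i ?J. (v(i := y)) l) \<partial>beta_law (real (Suc i)) 1
          \<partial>PiM ?J (\<lambda>j. beta_law (real (Suc j)) 1))"
    by (rule B.product_nn_integral_insert[OF J(2,3)]) measurable
  also have "\<dots> = (\<integral>\<^sup>+v. \<integral>\<^sup>+y. f (y * (\<Prod>l\<in>?J. v l)) \<partial>beta_law (real (Suc i)) 1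
          \<partial>PiM ?J (\<lambda>j. beta_law (real (Suc j)) 1))"
  proof (intro nn_integral_cong arg_cong[where f = f])
    fix v :: "nat \<Rightarrow> real" and y
    have "(\<Prod>l\<in>?J. (v(i := y)) l) = (\<Prod>l\<in>?J. v l)" by (intro prod.cong) auto
    then show "(\<Prod>l\<in>insert i ?J. (v(i := y)) l) = y * (\<Prod>l\<in>?J. v l)"
      unfolding prod.insert[OF J(2,3)] by (simp only: fun_upd_same)
  qed
  also have "\<dots> = (\<integral>\<^sup>+t. \<integral>\<^sup>+y. f (y * t) \<partial>beta_law (real (Suc i)) 1 \<partial>beta_law (real (Suc (Suc i))) (real (Suc k)))"
    by (rule Suc.IH[of "\<lambda>p. \<integral>\<^sup>+y. f (y * p) \<partial>beta_law (real (Suc i)) 1"]) measurable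
  also have "\<dots> = (\<integral>\<^sup>+t. f t \<partial>beta_law (real (Suc i)) (real (Suc (Suc k))))"
    by (rule nn_integral_beta_law_mult) fact
  finally show ?case by (simp only: J(1))
qed

section \<open>Order statistics of uniform samples\<close>

text \<open>
  The mixture of strict and weak inequalities breaks ties: only the first index attaining the
  maximum contributes.
\<close>

lemma sum_indicator_first_max:
  fixes u :: "'i::linorder \<Rightarrow> real"
  assumes "finite I" "I \<noteq> {}"
  shows "(\<Sum>m\<in>I. \<Prod>j\<in>I - {m}. indicator (if j < m then {..<u m} else {..u m}) (u j)) = (1::ennreal)"
proof -
  \<comment> \<open>The first index attaining the maximum; its summand is 1 and all others
    vanish.\<close>
  define m0 where "m0 = Min {j\<in>I. u j = Max (u ` I)}"
  have "Max (u ` I) \<in> u ` I" using assms by (intro Max_in) auto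
  then obtain j where "j \<in> I" "u j = Max (u ` I)" by force
  then have m0: "m0 \<in> {j\<in>I. u j = Max (u ` I)}"
    unfolding m0_def using assms by (intro Min_in) auto
  then have u_le: "u j \<le> u m0" if "j \<in> I" for j
    using assms that by simp
  have u_less: "u j < u m0" if "j \<in> I" "j < m0" for j
  proof -
    have "u j \<noteq> Max (u ` I)"
    proof
      assume "u j = Max (u ` I)"
      then have "m0 \<le> j" unfolding m0_def using assms that by (intro Min_le) auto
      with that show False by simp
    qed
    then show ?thesis using u_le[OF that(1)] m0 by simp
  qed
  have "(\<Prod>j\<in>I - {m}. indicator (if j < m then {..<u m} else {..u m}) (u j)) = (if m = m0 then 1 else 0 :: ennreal)"
    if m: "m \<in> I" for m
  proof (cases "m = m0")
    case True
    then show ?thesis using u_le u_less by (auto intro!: prod.neutral)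
  next
    case False
    \<comment> \<open>The factor at \<open>j = m0\<close> vanishes: for \<open>m0 < m\<close> it
      demands \<open>u m0 < u m\<close>, for \<open>m < m0\<close> it demands
      \<open>u m0 \<le> u m\<close>, and both fail.\<close>
    have "u m0 \<notin> (if m0 < m then {..<u m} else {..u m})"
      using u_le[OF m] u_less[OF m] False by (cases m m0 rule: linorder_cases) auto
    then have "indicator (if m0 < m then {..<u m} else {..u m}) (u m0) = (0::ennreal)"
      by (rule indicator_simps)
    then show ?thesis using m0 False assms
      by (auto intro!: prod_zero bexI[of _ m0])
  qed
  then have "(\<Sum>m\<in>I. \<Prod>j\<in>I - {m}. indicator (if j < m then {..<u m} else {..u m}) (u j))
      = (\<Sum>m\<in>I. if m = m0 then 1 else 0 :: ennreal)"
    by (intro sum.cong) auto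
  then show ?thesis using m0 assms by simp
qed

text \<open>
  Allowing an arbitrary index set \<open>I\<close> replaces the symmetry argument: removing the index \<open>m\<close> of the
  maximum leaves a sample indexed by \<open>I - {m}\<close>, to which the induction hypothesis applies.
\<close>

lemma nn_integral_order_stat_unit_uniform:
  fixes I :: "'i::linorder set"
  assumes "finite I" "card I = n" "f \<in> borel_measurable (PiM {..<n} (\<lambda>_. borel))"
  shows "(\<integral>\<^sup>+u. f (\<lambda>i\<in>{..<n}. order_stat I u i) \<partial>PiM I (\<lambda>_. unit_uniform))
       = (\<integral>\<^sup>+v. f (\<lambda>i\<in>{..<n}. \<Prod>l\<in>{i..<n}. v l) \<partial>PiM {..<n} (\<lambda>j. beta_law (real (Suc j)) 1))"
  using assms
proof (induction n arbitrary: I f)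
  case 0
  then show ?case by (simp add: PiM_empty)
next
  case (Suc n I f)
  note [measurable] = Suc.prems(3)
  have fin[simp]: "finite I" and card: "card I = Suc n" by fact+
  \<comment> \<open>\<open>E m j t\<close> is where coordinate \<open>j\<close> must lie for
    \<open>m\<close> to be the first index attaining the maximum \<open>t\<close>.\<close>
  define E where "E m j t = (if j < m then {..<t} else {..t})" for m j :: 'i and t :: real
  have E[measurable]: "(\<lambda>x. indicator (E m j (g x)) (h x) :: ennreal) \<in> borel_measurable N"
    if [measurable]: "g \<in> borel_measurable N" "h \<in> borel_measurable N"
    for m j g h and N :: "'x measure"
    unfolding E_def indicator_def by (cases "j < m") simp_all
  define G where "G v = (\<lambda>i\<in>{..<Suc n}. \<Prod>l\<in>{i..<Suc n}. v l)" for v :: "nat \<Rightarrow> real"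
  have G[measurable]: "G \<in> measurable (PiM {..<Suc n} (\<lambda>_. borel)) (PiM {..<Suc n} (\<lambda>_. borel))"
    unfolding G_def by (intro measurable_restrict borel_measurable_prod measurable_component_singleton) auto
  have [measurable]: "(\<lambda>u. \<lambda>i\<in>{..<Suc n}. order_stat I u i)
      \<in> measurable (PiM I (\<lambda>_. borel)) (PiM {..<Suc n} (\<lambda>_. borel))"
    using card by (intro measurable_restrict measurable_order_stat) auto
  \<comment> \<open>\<open>K t\<close> is the right-hand integral with the top factor
    \<open>v n\<close> fixed at \<open>t\<close>.\<close>
  define K where "K t = (\<integral>\<^sup>+v. f (G (v(n := t))) \<partial>PiM {..<n} (\<lambda>j. beta_law (real (Suc j)) 1))" for t
  have K[measurable]: "K \<in> borel_measurable borel"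
  proof -
    have upd: "(\<lambda>(t, v). v(n := t)) \<in> measurable (borel \<Otimes>\<^sub>M PiM {..<n} (\<lambda>_. borel)) (PiM {..<Suc n} (\<lambda>_. borel))"
      unfolding case_prod_beta by (rule measurable_fun_upd[where J = "{..<n}"]) auto
    have S: "sets (borel \<Otimes>\<^sub>M PiM {..<n} (\<lambda>j. beta_law (real (Suc j)) 1))
        = sets (borel \<Otimes>\<^sub>M PiM {..<n} (\<lambda>_. borel))"
      by (intro sets_pair_measure_cong sets_PiM_cong) simp_all
    have [measurable]: "(\<lambda>(t, v). v(n := t))
        \<in> measurable (borel \<Otimes>\<^sub>M PiM {..<n} (\<lambda>j. beta_law (real (Suc j)) 1)) (PiM {..<Suc n} (\<lambda>_. borel))"
      using upd unfolding measurable_cong_sets[OF S refl] .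
    interpret sigma_finite_measure "PiM {..<n} (\<lambda>j. beta_law (real (Suc j)) 1)"
      by (rule B.sigma_finite) simp
    show ?thesis unfolding K_def by measurable
  qed
  have meas: "(\<lambda>u. f (\<lambda>i\<in>{..<Suc n}. order_stat I u i) * (\<Prod>j\<in>I - {m}. indicator (E m j (u m)) (u j)))
      \<in> borel_measurable (PiM I (\<lambda>_. unit_uniform))" if m: "m \<in> I" for m
  proof -
    have "(\<lambda>u. f (\<lambda>i\<in>{..<Suc n}. order_stat I u i)) \<in> borel_measurable (PiM I (\<lambda>_. unit_uniform))"
      by measurable
    moreover have "(\<lambda>u. u j) \<in> borel_measurable (PiM I (\<lambda>_. unit_uniform))" if "j \<in> I" for j
      using that by simp
    ultimately show ?thesis
      using m by (intro borel_measurable_times_ennreal borel_measurable_prod_ennreal E) auto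
  qed
  \<comment> \<open>The event that \<open>m\<close> is the first index attaining the maximum
    contributes the same amount for every \<open>m\<close>.\<close>
  have peel: "(\<integral>\<^sup>+u. f (\<lambda>i\<in>{..<Suc n}. order_stat I u i) * (\<Prod>j\<in>I - {m}. indicator (E m j (u m)) (u j))
      \<partial>PiM I (\<lambda>_. unit_uniform)) = (\<integral>\<^sup>+t. ennreal t ^ n * K t \<partial>unit_uniform)" (is "?L = _")
    if m: "m \<in> I" for m
  proof -
    define J where "J = I - {m}"
    have J: "finite J" "m \<notin> J" "card J = n" "I = insert m J"
      using m card by (auto simp: J_def)
    have "?L = (\<integral>\<^sup>+u. f (\<lambda>i\<in>{..<Suc n}. order_stat I u i) * (\<Prod>j\<in>J. indicator (E m j (u m)) (u j))
        \<partial>PiM (insert m J) (\<lambda>_. unit_uniform))"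
      by (simp only: J_def[symmetric] J(4)[symmetric])
    also have "\<dots> = (\<integral>\<^sup>+t. \<integral>\<^sup>+u. f (\<lambda>i\<in>{..<Suc n}. order_stat I (u(m := t)) i)
        * (\<Prod>j\<in>J. indicator (E m j ((u(m := t)) m)) ((u(m := t)) j)) \<partial>PiM J (\<lambda>_. unit_uniform) \<partial>unit_uniform)"
      using meas[OF m] unfolding J_def[symmetric]
      by (intro U.product_nn_integral_insert_rev[OF J(1,2)]) (simp only: J(4)[symmetric])
    also have "\<dots> = (\<integral>\<^sup>+t. ennreal t ^ n * K t \<partial>unit_uniform)"
    proof (rule nn_integral_cong_AE, use AE_unit_uniform in eventually_elim)
      fix t :: real assume t: "0 < t \<and> t < 1"
      \<comment> \<open>\<open>h\<close> is \<open>f\<close> with the top entry fixed at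
        \<open>t\<close>, so it depends only on the order statistics of the remaining
        \<open>n\<close> variables.\<close>
      define h where "h w = f (\<lambda>i\<in>{..<Suc n}. if i = n then t else w i)" for w
      have h[measurable]: "h \<in> borel_measurable (PiM {..<n} (\<lambda>_. borel))"
        unfolding h_def
      proof (rule measurable_compose[OF measurable_restrict Suc.prems(3)])
        fix i assume "i \<in> {..<Suc n}"
        then show "(\<lambda>w. if i = n then t else w i) \<in> borel_measurable (PiM {..<n} (\<lambda>_. borel))"
          by (cases "i = n") simp_all
      qed
      have "(\<integral>\<^sup>+u. f (\<lambda>i\<in>{..<Suc n}. order_stat I (u(m := t)) i)
          * (\<Prod>j\<in>J. indicator (E m j ((u(m := t)) m)) ((u(m := t)) j)) \<partial>PiM J (\<lambda>_. unit_uniform))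
        = (\<integral>\<^sup>+u. h (\<lambda>i\<in>{..<n}. order_stat J u i) * (\<Prod>j\<in>J. indicator (E m j t) (u j)) \<partial>PiM J (\<lambda>_. unit_uniform))"
      proof (intro nn_integral_cong)
        fix u :: "'i \<Rightarrow> real"
        have eq: "(\<Prod>j\<in>J. indicator (E m j ((u(m := t)) m)) ((u(m := t)) j)) = (\<Prod>j\<in>J. indicator (E m j t) (u j) :: ennreal)"
          using J by (intro prod.cong) auto
        show "f (\<lambda>i\<in>{..<Suc n}. order_stat I (u(m := t)) i) * (\<Prod>j\<in>J. indicator (E m j ((u(m := t)) m)) ((u(m := t)) j))
          = h (\<lambda>i\<in>{..<n}. order_stat J u i) * (\<Prod>j\<in>J. indicator (E m j t) (u j))"
        \<comment> \<open>If some coordinate exceeds \<open>t\<close>, the product of indicators is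
          zero, so the order statistics have to be compared only when \<open>t\<close> is the
          maximum.\<close>
        proof (cases "\<forall>j\<in>J. u j \<le> t")
          case True
          have "(\<lambda>i\<in>{..<Suc n}. order_stat I (u(m := t)) i)
              = (\<lambda>i\<in>{..<Suc n}. if i = n then t else (\<lambda>i\<in>{..<n}. order_stat J u i) i)"
            unfolding J(4) using J(3) True
            by (intro restrict_ext) (simp add: order_stat_insert_max[OF J(1,2)])
          then show ?thesis unfolding eq h_def by simp
        next
          case False
          then obtain j where "j \<in> J" "t < u j" by (auto simp: not_le)
          then have z: "(\<Prod>j\<in>J. indicator (E m j t) (u j) :: ennreal) = 0"
            using J by (intro prod_zero bexI[of _ j]) (auto simp: E_def)
          then show ?thesis unfolding eq z by simp
        qed
      qed
      \<comment> \<open>Conditioning on values below \<open>t\<close>, an event of probability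
        \<open>t ^ n\<close>, turns the remaining sample into \<open>t\<close> times a uniform
        one.\<close>
      also have "\<dots> = ennreal t ^ n * (\<integral>\<^sup>+u. h (\<lambda>i\<in>{..<n}. order_stat J (\<lambda>j\<in>J. t * u j) i) \<partial>PiM J (\<lambda>_. unit_uniform))"
        unfolding J(3)[symmetric] using t J
        by (intro nn_integral_PiM_unit_uniform_scale[where f = "\<lambda>u. h (\<lambda>i\<in>{..<card J}. order_stat J u i)"])
           (auto simp: E_def)
      also have "(\<integral>\<^sup>+u. h (\<lambda>i\<in>{..<n}. order_stat J (\<lambda>j\<in>J. t * u j) i) \<partial>PiM J (\<lambda>_. unit_uniform))
          = (\<integral>\<^sup>+u. h (\<lambda>i\<in>{..<n}. t * (\<lambda>i\<in>{..<n}. order_stat J u i) i) \<partial>PiM J (\<lambda>_. unit_uniform))"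
      proof (intro nn_integral_cong arg_cong[where f = h] restrict_ext)
        fix u :: "'i \<Rightarrow> real" and i assume i: "i \<in> {..<n}"
        have "order_stat J (\<lambda>j\<in>J. t * u j) i = order_stat J (\<lambda>j. t * u j) i"
          using J(1) by (auto simp: order_stat_def intro!: arg_cong[where f = sorted_list_of_multiset] arg_cong2[where f = nth] image_mset_cong)
        also have "\<dots> = t * order_stat J u i"
          using i J t by (intro order_stat_map[where S = UNIV]) (auto intro!: mono_onI mult_left_mono)
        finally show "order_stat J (\<lambda>j\<in>J. t * u j) i = t * (\<lambda>i\<in>{..<n}. order_stat J u i) i"
          using i by simp
      qed
      also have "\<dots> = (\<integral>\<^sup>+v. h (\<lambda>i\<in>{..<n}. t * (\<lambda>i\<in>{..<n}. \<Prod>l\<in>{i..<n}. v l) i) \<partial>PiM {..<n} (\<lambda>j. beta_law (real (Suc j)) 1))"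
        by (rule Suc.IH[OF J(1,3)]) measurable
      \<comment> \<open>Multiplying the tail products up to index \<open>n - 1\<close> by
        \<open>t\<close> amounts to appending the factor \<open>v n = t\<close>; for
        \<open>i = n\<close> that factor stands alone.\<close>
      also have "\<dots> = K t"
        unfolding K_def h_def G_def
      proof (intro nn_integral_cong arg_cong[where f = f] restrict_ext)
        fix v :: "nat \<Rightarrow> real" and i assume "i \<in> {..<Suc n}"
        then show "(if i = n then t else (\<lambda>i\<in>{..<n}. t * (\<lambda>i\<in>{..<n}. \<Prod>l\<in>{i..<n}. v l) i) i)
            = (\<Prod>l\<in>{i..<Suc n}. (v(n := t)) l)"
          by (auto simp: prod.atLeastLessThan_Suc mult.commute intro!: prod.cong)
      qed
      finally show "(\<integral>\<^sup>+u. f (\<lambda>i\<in>{..<Suc n}. order_stat I (u(m := t)) i)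
          * (\<Prod>j\<in>J. indicator (E m j ((u(m := t)) m)) ((u(m := t)) j)) \<partial>PiM J (\<lambda>_. unit_uniform)) = ennreal t ^ n * K t" .
    qed
    finally show ?thesis .
  qed
  \<comment> \<open>A sum of indicators equal to 1 splits the integral according to the first index
    attaining the maximum.\<close>
  have "(\<integral>\<^sup>+u. f (\<lambda>i\<in>{..<Suc n}. order_stat I u i) \<partial>PiM I (\<lambda>_. unit_uniform))
      = (\<integral>\<^sup>+u. (\<Sum>m\<in>I. f (\<lambda>i\<in>{..<Suc n}. order_stat I u i) * (\<Prod>j\<in>I - {m}. indicator (E m j (u m)) (u j)))
          \<partial>PiM I (\<lambda>_. unit_uniform))"
  proof -
    have "(\<Sum>m\<in>I. \<Prod>j\<in>I - {m}. indicator (E m j (u m)) (u j)) = (1::ennreal)" for u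
      unfolding E_def using card by (intro sum_indicator_first_max) auto
    then show ?thesis by (simp flip: sum_distrib_left)
  qed
  also have "\<dots> = (\<Sum>m\<in>I. \<integral>\<^sup>+t. ennreal t ^ n * K t \<partial>unit_uniform)"
    by (subst nn_integral_sum) (simp_all add: peel meas)
  \<comment> \<open>The \<open>n + 1\<close> equal contributions with weight \<open>t ^ n\<close>
    make up the density of Beta(n + 1, 1).\<close>
  also have "\<dots> = (\<integral>\<^sup>+t. K t \<partial>beta_law (real (Suc n)) 1)"
    by (simp add: nn_integral_beta_law_Suc_1_cmult card del: of_nat_Suc)
  also have "\<dots> = (\<integral>\<^sup>+v. f (G v) \<partial>PiM (insert n {..<n}) (\<lambda>j. beta_law (real (Suc j)) 1))"
    unfolding K_def by (rule B.product_nn_integral_insert_rev[symmetric]) (simp_all flip: lessThan_Suc)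
  finally show ?case by (simp only: G_def lessThan_Suc)
qed

section \<open>Independent families and products over blocks of indices\<close>

lemma prob_space_distr_indep_vars:
  assumes "prob_space M" "prob_space.indep_vars M M' X I"
  shows "distr M (PiM I M') (\<lambda>\<omega>. \<lambda>i\<in>I. X i \<omega>) = PiM I (\<lambda>i. distr M (M' i) (X i))"
proof (cases "I = {}")
  case True
  interpret prob_space M by fact
  \<comment> \<open>The empty index set, which occurs for \<open>r = 0\<close>: both measures live
    on the one-point space of the constantly undefined function and have total mass 1.\<close>
  have "distr M (PiM {} M') (\<lambda>\<omega> i. undefined) = PiM {} (\<lambda>i. distr M (M' i) (X i))"
  proof (rule measure_eqI)
    fix A assume "A \<in> sets (distr M (PiM {} M') (\<lambda>\<omega> i. undefined))"
    then have "A = {} \<or> A = {\<lambda>_. undefined}" by (auto simp: sets_PiM_empty)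
    then show "emeasure (distr M (PiM {} M') (\<lambda>\<omega> i. undefined)) A = emeasure (PiM {} (\<lambda>i. distr M (M' i) (X i))) A"
      by (auto simp: emeasure_distr PiM_empty emeasure_space_1 measurable_count_space_eq2)
  qed (simp add: sets_PiM_empty)
  with True show ?thesis by (simp add: restrict_def)
next
  case False
  interpret prob_space M by fact
  have "\<And>i. i \<in> I \<Longrightarrow> random_variable (M' i) (X i)"
    using assms(2) by (auto simp: indep_vars_def2)
  from indep_vars_iff_distr_eq_PiM'[OF False this] show ?thesis
    using assms(2) by simp
qed

text \<open>The joint law of the coordinates is \<open>PiM I M\<close> itself, and its marginals are
  the \<open>M i\<close>.\<close>

lemma indep_vars_PiM_components:
  assumes "\<And>i. i \<in> I \<Longrightarrow> prob_space (M i)"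
  shows "prob_space.indep_vars (PiM I M) M (\<lambda>i \<omega>. \<omega> i) I"
proof (cases "I = {}")
  case True
  interpret prob_space "PiM I M" by (rule prob_space_PiM) fact
  show ?thesis
    unfolding indep_vars_def indep_sets_def using True by auto
next
  case False
  interpret prob_space "PiM I M" by (rule prob_space_PiM) fact
  have "distr (PiM I M) (PiM I M) (\<lambda>x. \<lambda>i\<in>I. x i) = distr (PiM I M) (PiM I M) (\<lambda>x. x)"
    by (intro distr_cong) (auto simp: space_PiM)
  also have "\<dots> = PiM I M" by simp
  also have "\<dots> = PiM I (\<lambda>i. distr (PiM I M) (M i) (\<lambda>\<omega>. \<omega> i))"
    using assms by (intro PiM_cong refl) (simp add: distr_PiM_component)
  finally show ?thesis
    using False by (subst indep_vars_iff_distr_eq_PiM') simp_all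
qed

text \<open>Restriction to the coordinates of the block has the product measure over the block as
  its law; there the integral identity for products, tested on indicators, gives the claim.\<close>

lemma distr_prod_block_beta_law:
  assumes "i + Suc k \<le> R"
  shows "distr (PiM {..<R} (\<lambda>j. beta_law (real (Suc j)) 1)) borel (\<lambda>v. \<Prod>l\<in>{i..<i + Suc k}. v l)
    = beta_law (real (Suc i)) (real (Suc k))"
proof -
  let ?B = "\<lambda>j. beta_law (real (Suc j)) 1"
  define J where "J = {i..<i + Suc k}"
  interpret BP: product_prob_space ?B "{..<R}"
    by (intro product_prob_spaceI prob_space_beta_law_Suc_1)
  have J: "J \<subseteq> {..<R}" "finite J" using assms by (auto simp: J_def)
  have r: "(\<lambda>v. restrict v J) \<in> measurable (PiM {..<R} ?B) (PiM J ?B)"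
    by (rule measurable_restrict_subset[OF J(1)])
  have m: "(\<lambda>v. \<Prod>l\<in>J. v l) \<in> borel_measurable (PiM J ?B)"
    by (intro borel_measurable_prod) simp
  have "distr (PiM {..<R} ?B) borel (\<lambda>v. \<Prod>l\<in>J. v l)
      = distr (distr (PiM {..<R} ?B) (PiM J ?B) (\<lambda>v. restrict v J)) borel (\<lambda>v. \<Prod>l\<in>J. v l)"
    unfolding distr_distr[OF m r] comp_def by (intro distr_cong prod.cong refl) simp
  also have "\<dots> = distr (PiM J ?B) borel (\<lambda>v. \<Prod>l\<in>J. v l)"
    by (simp only: BP.distr_PiM_restrict_finite[OF J(2,1)])
  also have "\<dots> = beta_law (real (Suc i)) (real (Suc k))"
  proof (rule measure_eqI)
    fix A assume "A \<in> sets (distr (PiM J ?B) borel (\<lambda>v. \<Prod>l\<in>J. v l))"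
    then have A: "A \<in> sets borel" by simp
    have "emeasure (distr (PiM J ?B) borel (\<lambda>v. \<Prod>l\<in>J. v l)) A
        = (\<integral>\<^sup>+x. indicator A x \<partial>distr (PiM J ?B) borel (\<lambda>v. \<Prod>l\<in>J. v l))"
      using A by (intro nn_integral_indicator[symmetric]) simp
    also have "\<dots> = (\<integral>\<^sup>+v. indicator A (\<Prod>l\<in>J. v l) \<partial>PiM J ?B)"
      using A by (intro nn_integral_distr[OF m] borel_measurable_indicator) simp
    also have "\<dots> = (\<integral>\<^sup>+x. indicator A x \<partial>beta_law (real (Suc i)) (real (Suc k)))"
      unfolding J_def using A by (intro nn_integral_prod_beta_law borel_measurable_indicator)
    also have "\<dots> = emeasure (beta_law (real (Suc i)) (real (Suc k))) A"
      using A by (intro nn_integral_indicator) simp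
    finally show "emeasure (distr (PiM J ?B) borel (\<lambda>v. \<Prod>l\<in>J. v l)) A = \<dots>" .
  qed (simp only: sets_distr sets_beta_law)
  finally show ?thesis unfolding J_def .
qed

lemma distr_order_stat_unit_uniform:
  fixes I :: "'i::linorder set"
  assumes I: "finite I" "card I = n"
  shows "distr (PiM I (\<lambda>_. unit_uniform)) (PiM {..<n} (\<lambda>_. borel)) (\<lambda>u. \<lambda>i\<in>{..<n}. order_stat I u i)
       = distr (PiM {..<n} (\<lambda>j. beta_law (real (Suc j)) 1)) (PiM {..<n} (\<lambda>_. borel))
           (\<lambda>v. \<lambda>i\<in>{..<n}. \<Prod>l\<in>{i..<n}. v l)" (is "?L = ?R")
proof (rule measure_eqI)
  have mL: "(\<lambda>u. \<lambda>i\<in>{..<n}. order_stat I u i) \<in> measurable (PiM I (\<lambda>_. unit_uniform)) (PiM {..<n} (\<lambda>_. borel))"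
  proof -
    have S: "sets (PiM I (\<lambda>_. unit_uniform)) = sets (PiM I (\<lambda>_. borel :: real measure))"
      by (intro sets_PiM_cong refl sets_unit_uniform)
    show ?thesis
      unfolding measurable_cong_sets[OF S refl]
      using I by (intro measurable_restrict measurable_order_stat) auto
  qed
  have mR: "(\<lambda>v. \<lambda>i\<in>{..<n}. \<Prod>l\<in>{i..<n}. v l)
      \<in> measurable (PiM {..<n} (\<lambda>j. beta_law (real (Suc j)) 1)) (PiM {..<n} (\<lambda>_. borel))"
    by (intro measurable_restrict borel_measurable_prod) simp
  fix A assume "A \<in> sets ?L"
  then have [measurable]: "A \<in> sets (PiM {..<n} (\<lambda>_. borel))" by simp
  have "emeasure ?L A = (\<integral>\<^sup>+x. indicator A x \<partial>?L)" by simp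
  also have "\<dots> = (\<integral>\<^sup>+u. indicator A (\<lambda>i\<in>{..<n}. order_stat I u i) \<partial>PiM I (\<lambda>_. unit_uniform))"
    by (rule nn_integral_distr[OF mL]) simp
  also have "\<dots> = (\<integral>\<^sup>+v. indicator A (\<lambda>i\<in>{..<n}. \<Prod>l\<in>{i..<n}. v l) \<partial>PiM {..<n} (\<lambda>j. beta_law (real (Suc j)) 1))"
    by (rule nn_integral_order_stat_unit_uniform[OF I]) simp
  also have "\<dots> = (\<integral>\<^sup>+x. indicator A x \<partial>?R)"
    by (rule nn_integral_distr[OF mR, symmetric]) simp
  also have "\<dots> = emeasure ?R A" by simp
  finally show "emeasure ?L A = emeasure ?R A" .
qed simp

text \<open>Each block lies directly below the preceding one, and \<open>k 0 = 0\<close> makes the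
  first block end at \<open>R\<close>, so together they fill the tail interval starting at
  \<open>R - k i\<close>.\<close>

lemma prod_prod_blocks:
  fixes v :: "nat \<Rightarrow> 'a::comm_monoid_mult" and k :: "nat \<Rightarrow> nat"
  assumes "k 0 = 0" "\<And>j. 1 \<le> j \<Longrightarrow> j \<le> i \<Longrightarrow> k (j - 1) \<le> k j \<and> k j \<le> R"
  shows "(\<Prod>j=1..i. \<Prod>l\<in>{R - k j..<R - k (j - 1)}. v l) = (\<Prod>l\<in>{R - k i..<R}. v l)"
  using assms(2)
proof (induction i)
  case 0
  then show ?case by (simp add: assms(1))
next
  case (Suc i)
  have "k i \<le> k (Suc i)" using Suc.prems[of "Suc i"] by simp
  then have "(\<Prod>l\<in>{R - k i..<R}. v l) * (\<Prod>l\<in>{R - k (Suc i)..<R - k i}. v l) = (\<Prod>l\<in>{R - k (Suc i)..<R}. v l)"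
    by (subst mult.commute) (intro prod.atLeastLessThan_concat, simp_all)
  with Suc show ?case by simp
qed

text \<open>The uniform case of the theorem. Both sides are expressed through one family of
  independent Beta(j + 1, 1) factors: products over blocks have the laws of the \<open>z i\<close>,
  and their partial products are the tail products that represent the order statistics.\<close>

lemma distr_prod_beta_law_eq_order_stat:
  fixes k :: "nat \<Rightarrow> nat"
  assumes k: "k 0 = 0" "strict_mono_on {1..r} k" "\<forall>i\<in>{1..r}. 1 \<le> k i \<and> k i \<le> R"
  shows "distr (PiM {1..r} (\<lambda>i. beta_law (real R - real (k i) + 1) (real (k i) - real (k (i - 1)))))
           (PiM {1..r} (\<lambda>_. borel)) (\<lambda>w. \<lambda>i\<in>{1..r}. \<Prod>j=1..i. w j)
       = distr (PiM {1..R} (\<lambda>_. unit_uniform)) (PiM {1..r} (\<lambda>_. borel))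
           (\<lambda>u. \<lambda>i\<in>{1..r}. order_stat {1..R} u (R - k i))"
proof -
  define B where "B j = beta_law (real (Suc j)) 1" for j
  define V where "V = PiM {..<R} B"
  \<comment> \<open>For \<open>i\<close> in \<open>{1..r}\<close> the block has
    \<open>k i - k (i - 1)\<close> elements, the second parameter of the law of
    \<open>z i\<close>.\<close>
  define K where "K i = {R - k i..<R - k (i - 1)}" for i
  define Pb where "Pb = PiM {1..r} (\<lambda>_. borel :: real measure)"
  have B: "prob_space (B j)" "sets (B j) = sets borel" for j
    by (simp_all only: B_def prob_space_beta_law_Suc_1 sets_beta_law)
  interpret V: prob_space V unfolding V_def by (intro prob_space_PiM B)
  have step: "k (i - 1) < k i" "k i \<le> R" if "i \<in> {1..r}" for i
  proof -
    show "k (i - 1) < k i"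
    \<comment> \<open>Strict monotonicity is given on \<open>{1..r}\<close>, so the step from
      \<open>k 0 = 0\<close> to \<open>k 1 \<ge> 1\<close> is a separate case.\<close>
    proof (cases "i = 1")
      case False
      with that have "i - 1 \<in> {1..r}" by auto
      then show ?thesis using that by (intro strict_mono_onD[OF k(2)]) auto
    qed (use k that in force)
  qed (use k that in auto)
  have mono: "k i \<le> k j" if "i \<in> {1..r}" "j \<in> {1..r}" "i \<le> j" for i j
    using that k(2) by (metis le_less strict_mono_onD)
  have K_subset: "K i \<subseteq> {..<R}" for i by (auto simp: K_def)
  have K_disj: "disjoint_family_on K {1..r}"
  proof -
    have "K i \<inter> K j = {}" if "i \<in> {1..r}" "j \<in> {1..r}" "i < j" for i j
    proof -
      have "k i \<le> k (j - 1)" using that by (intro mono) auto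
      then show ?thesis by (auto simp: K_def)
    qed
    then show ?thesis unfolding disjoint_family_on_def by (metis Int_commute linorder_neqE_nat)
  qed
  have indep: "V.indep_vars (\<lambda>_. borel) (\<lambda>i v. \<Prod>l\<in>K i. v l) {1..r}"
  proof -
    have "V.indep_vars B (\<lambda>j v. v j) {..<R}"
      unfolding V_def by (intro indep_vars_PiM_components B)
    from V.indep_vars_restrict[OF this K_subset K_disj]
    have "V.indep_vars (\<lambda>_. borel) (\<lambda>i v. (\<lambda>w. \<Prod>l\<in>K i. w l) (restrict v (K i))) {1..r}"
    proof (rule V.indep_vars_compose2)
      fix i
      have "sets (PiM (K i) B) = sets (PiM (K i) (\<lambda>_. borel))"
        by (intro sets_PiM_cong refl B)
      note S = measurable_cong_sets[OF this refl]
      show "(\<lambda>w. \<Prod>l\<in>K i. w l) \<in> borel_measurable (PiM (K i) B)"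
        unfolding S by (intro borel_measurable_prod measurable_component_singleton)
    qed
    then show ?thesis by simp
  qed
  have law: "distr V borel (\<lambda>v. \<Prod>l\<in>K i. v l) = beta_law (real R - real (k i) + 1) (real (k i) - real (k (i - 1)))"
    if i: "i \<in> {1..r}" for i
  proof -
    \<comment> \<open>With these values Beta(a + 1, b + 1) is the required law and the block is
      \<open>{a..<a + Suc b}\<close>; it is nonempty because \<open>k (i - 1) < k i\<close>.\<close>
    define a b where "a = R - k i" and "b = k i - k (i - 1) - 1"
    have ab: "R - k (i - 1) = a + Suc b" using step[OF i] by (simp add: a_def b_def)
    have "real (Suc a) = real R - real (k i) + 1" "real (Suc b) = real (k i) - real (k (i - 1))"
      using step[OF i] by (simp_all add: a_def b_def of_nat_diff)
    moreover have "K i = {a..<a + Suc b}" using ab by (simp add: K_def a_def)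
    moreover have "a + Suc b \<le> R" using ab by linarith
    ultimately show ?thesis
      unfolding V_def B_def by (metis distr_prod_block_beta_law)
  qed
  have mK: "(\<lambda>v. \<lambda>i\<in>{1..r}. \<Prod>l\<in>K i. v l) \<in> measurable V Pb"
    using indep unfolding V.indep_vars_def2 Pb_def by (intro measurable_restrict) simp
  have mprod: "(\<lambda>w. \<lambda>i\<in>{1..r}. \<Prod>j=1..i. w j) \<in> measurable Pb Pb"
    unfolding Pb_def by (intro measurable_restrict borel_measurable_prod measurable_component_singleton) auto
  have mS: "(\<lambda>v. \<lambda>i\<in>{..<R}. \<Prod>l\<in>{i..<R}. v l) \<in> measurable V (PiM {..<R} (\<lambda>_. borel))"
  proof -
    have "sets V = sets (PiM {..<R} (\<lambda>_. borel))"
      unfolding V_def by (intro sets_PiM_cong refl B)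
    note S = measurable_cong_sets[OF this refl]
    show ?thesis
      unfolding S by (intro measurable_restrict borel_measurable_prod measurable_component_singleton) auto
  qed
  have mU: "(\<lambda>u. \<lambda>i\<in>{..<R}. order_stat {1..R} u i) \<in> measurable (PiM {1..R} (\<lambda>_. unit_uniform)) (PiM {..<R} (\<lambda>_. borel))"
  proof -
    have "sets (PiM {1..R} (\<lambda>_. unit_uniform)) = sets (PiM {1..R} (\<lambda>_. borel :: real measure))"
      by (intro sets_PiM_cong refl sets_unit_uniform)
    note S = measurable_cong_sets[OF this refl]
    show ?thesis
      unfolding S by (intro measurable_restrict measurable_order_stat) auto
  qed
  have lt: "R - k i \<in> {..<R}" if "i \<in> {1..r}" for i using k(3) that by force
  have msel: "(\<lambda>w. \<lambda>i\<in>{1..r}. w (R - k i)) \<in> measurable (PiM {..<R} (\<lambda>_. borel)) Pb"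
    unfolding Pb_def using lt by (intro measurable_restrict measurable_component_singleton)
  have "distr (PiM {1..r} (\<lambda>i. beta_law (real R - real (k i) + 1) (real (k i) - real (k (i - 1)))))
           Pb (\<lambda>w. \<lambda>i\<in>{1..r}. \<Prod>j=1..i. w j)
      = distr (PiM {1..r} (\<lambda>i. distr V borel (\<lambda>v. \<Prod>l\<in>K i. v l))) Pb (\<lambda>w. \<lambda>i\<in>{1..r}. \<Prod>j=1..i. w j)"
    using law by (intro distr_cong PiM_cong refl) simp_all
  also have "\<dots> = distr (distr V Pb (\<lambda>v. \<lambda>i\<in>{1..r}. \<Prod>l\<in>K i. v l)) Pb (\<lambda>w. \<lambda>i\<in>{1..r}. \<Prod>j=1..i. w j)"
    unfolding Pb_def by (subst prob_space_distr_indep_vars[OF V.prob_space_axioms indep]) (rule refl)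
  also have "\<dots> = distr V Pb (\<lambda>v. \<lambda>i\<in>{1..r}. \<Prod>l\<in>{R - k i..<R}. v l)"
    unfolding distr_distr[OF mprod mK] comp_def
  proof (intro distr_cong refl restrict_ext)
    fix v :: "nat \<Rightarrow> real" and i assume i: "i \<in> {1..r}"
    have "(\<Prod>j=1..i. (\<lambda>i\<in>{1..r}. \<Prod>l\<in>K i. v l) j) = (\<Prod>j=1..i. \<Prod>l\<in>K j. v l)"
      using i by (intro prod.cong refl) auto
    also have "\<dots> = (\<Prod>l\<in>{R - k i..<R}. v l)"
      unfolding K_def
    proof (rule prod_prod_blocks[of k, OF k(1)])
      show "k (j - 1) \<le> k j \<and> k j \<le> R" if "1 \<le> j" "j \<le> i" for j
        using step[of j] i that by auto
    qed
    finally show "(\<Prod>j=1..i. (\<lambda>i\<in>{1..r}. \<Prod>l\<in>K i. v l) j) = (\<Prod>l\<in>{R - k i..<R}. v l)" .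
  qed
  also have "\<dots> = distr (distr V (PiM {..<R} (\<lambda>_. borel)) (\<lambda>v. \<lambda>i\<in>{..<R}. \<Prod>l\<in>{i..<R}. v l)) Pb
      (\<lambda>w. \<lambda>i\<in>{1..r}. w (R - k i))"
    unfolding distr_distr[OF msel mS] comp_def using lt by (intro distr_cong refl restrict_ext) simp
  also have "\<dots> = distr (distr (PiM {1..R} (\<lambda>_. unit_uniform)) (PiM {..<R} (\<lambda>_. borel))
      (\<lambda>u. \<lambda>i\<in>{..<R}. order_stat {1..R} u i)) Pb (\<lambda>w. \<lambda>i\<in>{1..r}. w (R - k i))"
    unfolding V_def B_def by (subst distr_order_stat_unit_uniform) simp_all
  also have "\<dots> = distr (PiM {1..R} (\<lambda>_. unit_uniform)) Pb (\<lambda>u. \<lambda>i\<in>{1..r}. order_stat {1..R} u (R - k i))"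
    unfolding distr_distr[OF msel mU] comp_def using lt by (intro distr_cong refl restrict_ext) simp
  finally show ?thesis unfolding Pb_def .
qed

section \<open>Quantile transform\<close>

text \<open>By \<open>pseudoinverse\<close>, \<open>y \<le> cdf P x\<close> holds exactly when the
  infimum is at most \<open>x\<close>; taking the infimum itself for \<open>x\<close> shows that it
  is attained.\<close>

lemma inv_cdf_eq_Inf:
  assumes "real_distribution P" "0 < y" "y < 1"
  shows "inv_cdf P y = Inf {x. y \<le> cdf P x}"
proof -
  interpret cdf_distribution P using assms by (simp add: cdf_distribution_def)
  show ?thesis
    unfolding inv_cdf_def
  proof (rule Least_equality)
    show "y \<le> cdf P (Inf {x. y \<le> cdf P x})"
      using pseudoinverse[OF assms(2,3)] by blast
    show "Inf {x. y \<le> cdf P x} \<le> x" if "y \<le> cdf P x" for x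
      using pseudoinverse[OF assms(2,3)] that by blast
  qed
qed

lemma mono_on_inv_cdf:
  assumes "real_distribution P"
  shows "mono_on {0<..<1} (inv_cdf P)"
proof -
  interpret cdf_distribution P using assms by (simp add: cdf_distribution_def)
  show ?thesis
    using mono_I inv_cdf_eq_Inf[OF assms] by (simp add: mono_on_def)
qed

text \<open>
  Outside \<open>(0,1)\<close> the unspecified value of the \<open>LEAST\<close> operator is constant on each of the
  ranges \<open>y \<le> 0\<close> and \<open>y > 1\<close>, because there the defining predicate does not depend on \<open>y\<close>.
\<close>

lemma measurable_inv_cdf [measurable]:
  assumes "real_distribution P"
  shows "inv_cdf P \<in> borel_measurable borel"
proof -
  interpret cdf_distribution P using assms by (simp add: cdf_distribution_def)
  \<comment> \<open>Extension by 0 transfers measurability of the quantile function from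
    \<open>(0,1)\<close> to the whole line.\<close>
  define g where "g y = (if y \<in> {0<..<1} then Inf {x. y \<le> cdf P x} else 0)" for y
  have g[measurable]: "g \<in> borel_measurable borel"
    using measurable_CI unfolding g_def by (subst (asm) measurable_restrict_space_iff[where c = 0]) auto
  have "inv_cdf P = (\<lambda>y. if 0 < y \<and> y < 1 then g y else if y \<le> 0 then (LEAST x. True)
      else if y = 1 then inv_cdf P 1 else (LEAST x. False))"
  proof
    fix y
    have "\<not> y \<le> cdf P x" if "y > 1" for x using that cdf_bounded_prob[of x] by linarith
    moreover have "y \<le> cdf P x" if "y \<le> 0" for x using that cdf_nonneg[of x] by linarith
    ultimately show "inv_cdf P y = (if 0 < y \<and> y < 1 then g y else if y \<le> 0 then (LEAST x. True)
      else if y = 1 then inv_cdf P 1 else (LEAST x. False))"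
      using inv_cdf_eq_Inf[OF assms, of y] by (auto simp: g_def inv_cdf_def)
  qed
  also have "\<dots> \<in> borel_measurable borel" by measurable
  finally show ?thesis .
qed

text \<open>Inverse transform sampling: on \<open>(0,1)\<close> the function agrees with the
  pseudoinverse \<open>I\<close>, under which the uniform law has image \<open>P\<close>.\<close>

lemma distr_inv_cdf_unit_uniform:
  assumes "real_distribution P"
  shows "distr unit_uniform borel (inv_cdf P) = P"
proof -
  interpret cdf_distribution P using assms by (simp add: cdf_distribution_def)
  note [measurable] = measurable_inv_cdf[OF assms]
  have "distr unit_uniform borel (inv_cdf P) = distr (restrict_space lborel {0<..<1}) borel I"
  proof (rule measure_eqI)
    fix A assume "A \<in> sets (distr unit_uniform borel (inv_cdf P))"
    then have [measurable]: "A \<in> sets borel" by simp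
    have [measurable]: "inv_cdf P -` A \<in> sets borel"
      using measurable_sets[OF measurable_inv_cdf[OF assms], of A] by simp
    have "emeasure (distr unit_uniform borel (inv_cdf P)) A = emeasure unit_uniform (inv_cdf P -` A)"
      by (subst emeasure_distr) simp_all
    also have "\<dots> = emeasure lborel ({0<..<1} \<inter> inv_cdf P -` A)"
      unfolding unit_uniform_def by (subst emeasure_density) (simp_all flip: indicator_inter_arith)
    also have "{0<..<1} \<inter> inv_cdf P -` A = I -` A \<inter> {0<..<1}"
      using inv_cdf_eq_Inf[OF assms] by auto
    also have "emeasure lborel (I -` A \<inter> {0<..<1}) = emeasure (distr (restrict_space lborel {0<..<1}) borel I) A"
      by (subst emeasure_distr) (simp_all add: emeasure_restrict_space space_restrict_space)
    finally show "emeasure (distr unit_uniform borel (inv_cdf P)) A = emeasure (distr (restrict_space lborel {0<..<1}) borel I) A" .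
  qed simp
  then show ?thesis by (simp only: distr_I_eq_M)
qed

section \<open>Order statistics of samples from \<open>P\<close>\<close>

lemma kth_largest_eq_order_stat:
  assumes "1 \<le> k" "k \<le> R"
  shows "kth_largest k (map x [1..<R + 1]) = order_stat {1..R} x (R - k)"
proof -
  have "mset (map x [1..<R + 1]) = image_mset x (mset_set {1..R})"
    by (simp only: mset_map mset_upt Suc_eq_plus1[symmetric] atLeastLessThanSuc_atLeastAtMost)
  then have "sort (map x [1..<R + 1]) = sorted_list_of_multiset (image_mset x (mset_set {1..R}))"
    by (metis sorted_list_of_multiset_mset)
  moreover have "length (sort (map x [1..<R + 1])) = R" by simp
  \<comment> \<open>Reversal turns position \<open>k - 1\<close> from the top into position
    \<open>R - k\<close> from the bottom.\<close>
  moreover have "rev ys ! (k - 1) = ys ! (R - k)" if "length ys = R" for ys :: "real list"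
    using that assms by (subst rev_nth) auto
  ultimately show ?thesis by (simp only: kth_largest_def order_stat_def)
qed

theorem theoremB5:
  fixes P :: "real measure"
    and M :: "'a measure" and N :: "'b measure"
    and R r :: nat and k :: "nat \<Rightarrow> nat"
    and z :: "nat \<Rightarrow> 'a \<Rightarrow> real" and x :: "nat \<Rightarrow> 'b \<Rightarrow> real"
  assumes P: "real_distribution P" "absolutely_continuous lborel P"
    and R: "R \<ge> 1"
    and k: "k 0 = 0" "strict_mono_on {1..r} k" "\<forall>i\<in>{1..r}. 1 \<le> k i \<and> k i \<le> R"
    and M: "prob_space M" "prob_space.indep_vars M (\<lambda>_. borel) z {1..r}"
    and z: "\<forall>i\<in>{1..r}. distributed M lborel (z i)
              (\<lambda>t. ennreal (beta_density (real R - real (k i) + 1) (real (k i) - real (k (i - 1))) t))"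
    and N: "prob_space N" "prob_space.indep_vars N (\<lambda>_. borel) x {1..R}"
    and x: "\<forall>j\<in>{1..R}. distr N borel (x j) = P"
  shows "distr M (PiM {1..r} (\<lambda>_. borel)) (\<lambda>\<omega>. \<lambda>i\<in>{1..r}. inv_cdf P (\<Prod>j=1..i. z j \<omega>))
       = distr N (PiM {1..r} (\<lambda>_. borel)) (\<lambda>\<omega>. \<lambda>i\<in>{1..r}. kth_largest (k i) (map (\<lambda>j. x j \<omega>) [1..<R + 1]))"
proof -
  interpret P: real_distribution P by fact
  define Pb where "Pb = PiM {1..r} (\<lambda>_. borel :: real measure)"
  define PR where "PR = PiM {1..R} (\<lambda>_. borel :: real measure)"
  define UR where "UR = PiM {1..R} (\<lambda>_. unit_uniform)"
  define Z where "Z = PiM {1..r} (\<lambda>i. beta_law (real R - real (k i) + 1) (real (k i) - real (k (i - 1))))"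
  \<comment> \<open>The left-hand side is the law of the \<open>z i\<close> carried along by
    \<open>S\<close> and then \<open>F\<close>; the right-hand side is the law of the
    \<open>x j\<close> carried along by \<open>T\<close>.\<close>
  define F where "F w = (\<lambda>i\<in>{1..r}. inv_cdf P (w i))" for w :: "nat \<Rightarrow> real"
  define S where "S w = (\<lambda>i\<in>{1..r}. \<Prod>j=1..i. w j)" for w :: "nat \<Rightarrow> real"
  define T where "T u = (\<lambda>i\<in>{1..r}. order_stat {1..R} u (R - k i))" for u :: "nat \<Rightarrow> real"
  have lt: "R - k i < card {1..R}" if "i \<in> {1..r}" for i using k(3) that by force
  have mF: "F \<in> measurable Pb Pb"
    unfolding F_def Pb_def
    by (intro measurable_restrict measurable_compose[OF _ measurable_inv_cdf[OF P(1)]] measurable_component_singleton)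
  have mS: "S \<in> measurable Pb Pb"
    unfolding S_def Pb_def by (intro measurable_restrict borel_measurable_prod measurable_component_singleton) auto
  have mT: "T \<in> measurable PR Pb"
    unfolding T_def Pb_def PR_def using lt by (intro measurable_restrict measurable_order_stat) auto
  have mz: "(\<lambda>\<omega>. \<lambda>i\<in>{1..r}. z i \<omega>) \<in> measurable M Pb"
    using M unfolding prob_space.indep_vars_def2[OF M(1)] Pb_def by (intro measurable_restrict) simp
  have mx: "(\<lambda>\<omega>. \<lambda>i\<in>{1..R}. x i \<omega>) \<in> measurable N PR"
    using N unfolding prob_space.indep_vars_def2[OF N(1)] PR_def by (intro measurable_restrict) simp
  have UR_PR: "sets UR = sets PR"
    unfolding UR_def PR_def by (intro sets_PiM_cong refl sets_unit_uniform)
  have mTU: "T \<in> measurable UR Pb"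
    using mT by (simp only: measurable_cong_sets[OF UR_PR refl])
  have mG: "compose {1..R} (inv_cdf P) \<in> measurable UR PR"
    unfolding compose_def measurable_cong_sets[OF UR_PR refl] PR_def
    by (intro measurable_restrict measurable_compose[OF _ measurable_inv_cdf[OF P(1)]] measurable_component_singleton)
  have mSz: "S \<circ> (\<lambda>\<omega>. \<lambda>i\<in>{1..r}. z i \<omega>) \<in> measurable M Pb" using mz mS by (rule measurable_comp)
  have law_z: "distr M borel (z i) = beta_law (real R - real (k i) + 1) (real (k i) - real (k (i - 1)))"
    if "i \<in> {1..r}" for i
    using z that unfolding distributed_def beta_law_def
    by (metis distr_cong sets_lborel)
  have "distr M Pb (\<lambda>\<omega>. \<lambda>i\<in>{1..r}. inv_cdf P (\<Prod>j=1..i. z j \<omega>))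
      = distr (distr (distr M Pb (\<lambda>\<omega>. \<lambda>i\<in>{1..r}. z i \<omega>)) Pb S) Pb F"
    unfolding distr_distr[OF mS mz] distr_distr[OF mF mSz] unfolding comp_def F_def S_def
    by (intro distr_cong refl restrict_ext) (auto intro!: arg_cong[where f = "inv_cdf P"] prod.cong)
  also have "distr M Pb (\<lambda>\<omega>. \<lambda>i\<in>{1..r}. z i \<omega>) = Z"
    unfolding Pb_def Z_def prob_space_distr_indep_vars[OF M]
    by (intro PiM_cong refl law_z)
  also have "distr Z Pb S = distr UR Pb T"
    unfolding Z_def Pb_def S_def[abs_def] T_def[abs_def] UR_def
    by (rule distr_prod_beta_law_eq_order_stat[OF k])
  also have "distr (distr UR Pb T) Pb F = distr UR Pb (F \<circ> T)"
    by (rule distr_distr[OF mF mTU])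
  \<comment> \<open>The quantile function is monotone on \<open>(0,1)\<close>, so it commutes with
    order statistics whenever all coordinates lie there, which is almost everywhere.\<close>
  also have "\<dots> = distr UR Pb (T \<circ> compose {1..R} (inv_cdf P))"
  proof (rule distr_cong_AE)
    have "AE u in UR. \<forall>j\<in>{1..R}. 0 < u j \<and> u j < 1"
      unfolding UR_def
      by (intro eventually_ball_finite ballI AE_PiM_component prob_space_unit_uniform AE_unit_uniform) auto
    then show "AE u in UR. (F \<circ> T) u = (T \<circ> compose {1..R} (inv_cdf P)) u"
    proof eventually_elim
      fix u :: "nat \<Rightarrow> real" assume u: "\<forall>j\<in>{1..R}. 0 < u j \<and> u j < 1"
      have "inv_cdf P (order_stat {1..R} u (R - k i)) = order_stat {1..R} (compose {1..R} (inv_cdf P) u) (R - k i)"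
        if i: "i \<in> {1..r}" for i
      proof -
        have "order_stat {1..R} (compose {1..R} (inv_cdf P) u) (R - k i) = order_stat {1..R} (\<lambda>j. inv_cdf P (u j)) (R - k i)"
          unfolding order_stat_def
          by (intro arg_cong2[where f = nth] arg_cong[where f = sorted_list_of_multiset] image_mset_cong refl)
             (simp add: compose_def)
        also have "\<dots> = inv_cdf P (order_stat {1..R} u (R - k i))"
          using u by (intro order_stat_map[OF _ lt[OF i] mono_on_inv_cdf[OF P(1)]]) auto
        finally show ?thesis by simp
      qed
      then show "(F \<circ> T) u = (T \<circ> compose {1..R} (inv_cdf P)) u"
        unfolding F_def T_def comp_def by (intro restrict_ext) simp
    qed
  qed (use mF mTU mG mT in \<open>auto intro: measurable_comp\<close>)
  also have "\<dots> = distr (distr UR PR (compose {1..R} (inv_cdf P))) Pb T"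
    by (rule distr_distr[OF mT mG, symmetric])
  \<comment> \<open>With codomain \<open>P\<close>, which has the same measurable sets as
    \<open>borel\<close>, the target becomes a product of probability spaces.\<close>
  also have "distr UR PR (compose {1..R} (inv_cdf P)) = distr UR (PiM {1..R} (\<lambda>_. P)) (compose {1..R} (inv_cdf P))"
    unfolding PR_def by (intro distr_cong refl sets_PiM_cong P.events_eq_borel[symmetric])
  also have "\<dots> = PiM {1..R} (\<lambda>_. distr unit_uniform P (inv_cdf P))"
    unfolding UR_def
  proof (rule distr_PiM_finite_prob_space')
    show "inv_cdf P \<in> measurable unit_uniform P"
      unfolding measurable_cong_sets[OF sets_unit_uniform P.events_eq_borel] by (rule measurable_inv_cdf[OF P(1)])
  qed (simp_all add: prob_space_unit_uniform P.prob_space_axioms)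
  also have "\<dots> = PiM {1..R} (\<lambda>_. distr unit_uniform borel (inv_cdf P))"
    by (intro PiM_cong distr_cong refl P.events_eq_borel)
  \<comment> \<open>The transformed uniform sample is i.i.d. with law \<open>P\<close>, hence has
    the joint law of the \<open>x j\<close>.\<close>
  also have "\<dots> = PiM {1..R} (\<lambda>j. distr N borel (x j))"
    using x by (intro PiM_cong refl) (simp add: distr_inv_cdf_unit_uniform[OF P(1)])
  also have "\<dots> = distr N PR (\<lambda>\<omega>. \<lambda>i\<in>{1..R}. x i \<omega>)"
    unfolding PR_def by (rule prob_space_distr_indep_vars[OF N, symmetric])
  also have "distr (distr N PR (\<lambda>\<omega>. \<lambda>i\<in>{1..R}. x i \<omega>)) Pb T
      = distr N Pb (\<lambda>\<omega>. \<lambda>i\<in>{1..r}. kth_largest (k i) (map (\<lambda>j. x j \<omega>) [1..<R + 1]))"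
    unfolding distr_distr[OF mT mx] unfolding comp_def T_def
  proof (intro distr_cong refl restrict_ext)
    fix \<omega> i assume "i \<in> {1..r}"
    then have "kth_largest (k i) (map (\<lambda>j. x j \<omega>) [1..<R + 1]) = order_stat {1..R} (\<lambda>j. x j \<omega>) (R - k i)"
      using k(3) by (intro kth_largest_eq_order_stat) auto
    also have "\<dots> = order_stat {1..R} (\<lambda>i\<in>{1..R}. x i \<omega>) (R - k i)"
      unfolding order_stat_def
      by (intro arg_cong2[where f = nth] arg_cong[where f = sorted_list_of_multiset] image_mset_cong refl) simp
    finally show "order_stat {1..R} (\<lambda>i\<in>{1..R}. x i \<omega>) (R - k i) = kth_largest (k i) (map (\<lambda>j. x j \<omega>) [1..<R + 1])" ..
  qed
  finally show ?thesis unfolding Pb_def .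
qed

end
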